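(* Let $n$ be a positive integer and let $k\geqslant 0$ be an even integer. Then $$\frac{3^{k+1}+1}{4}E_k\equiv\frac{3^k}{2}\sum_{j=0}^{2^n-1}(-1)^{j-1}(2j+1)^k\left\lfloor\frac{3j+1}{2^n}\right\rfloor\pmod{2^n},$$ and moreover, for every positive odd integer $m$, $$\frac{m^{k+1}-(-1)^{(m-1)/2}}{4}E_k\equiv\frac{m^k}{2}\sum_{j=0}^{2^n-1}(-1)^{j-1}(2j+1)^k\left\lfloor\frac{jm+(m-1)/2}{2^n}\right\rfloor\pmod{2^n}.$$
   Context: The Euler numbers $E_0,E_1,E_2,\ldots$ are the integers defined by $E_0=1$ and $E_n=-\sum_{0\leqslant k\leqslant n-1,\ 2\mid n-k}\binom{n}{k}E_k$ for $n\geqslant 1$ (equivalently $\sec x=\sum_{n\geqslant0}(-1)^nE_{2n}x^{2n}/(2n)!$ and $E_{2n+1}=0$). $\lfloor\alpha\rfloor$ denotes the greatest integer not exceeding $\alpha$. For an integer $q>1$, $\mathbb{Z}_q$ denotes the ring of rationals $a/b$ with $a\in\mathbb{Z}$, $b\in\mathbb{Z}^+$, $\gcd(b,q)=1$; for $\alpha,\beta\in\mathbb{Z}_q$, $\alpha\equiv\beta\pmod q$ means $\alpha-\beta=q\gamma$ for some $\gamma\in\mathbb{Z}_q$. *)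

theory Defs
  imports Complex_Main
begin

function euler_number :: "nat \<Rightarrow> int" where
  "euler_number n =
     (if n = 0 then 1
      else - (\<Sum>k | k \<le> n - 1 \<and> even (n - k). int (n choose k) * euler_number k))"
  by auto
termination
  by (relation "measure id") auto

declare euler_number.simps [simp del]

definition rat_ring :: "nat \<Rightarrow> rat set" where
  "rat_ring q = {of_int a / of_nat b | (a :: int) (b :: nat). b > 0 \<and> coprime b q}"

text \<open>Membership of both sides is part of the relation, so a congruence also asserts
  that its two sides have denominators coprime to the modulus.\<close>

definition rat_cong :: "rat \<Rightarrow> rat \<Rightarrow> nat \<Rightarrow> bool" where
  "rat_cong x y q \<longleftrightarrow>
     x \<in> rat_ring q \<and> y \<in> rat_ring q \<and> (\<exists>z \<in> rat_ring q. x - y = of_nat q * z)"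

end

theory Submission
  imports Defs "HOL-Number_Theory.Cong"
begin

text \<open>Put \<open>N = 2 ^ n\<close>, \<open>p = k + 1\<close> and divide with remainder, \<open>j m + (m - 1) / 2 = N q\<^sub>j + r\<^sub>j\<close>, so that
  \<open>m (2 j + 1) = 2 N q\<^sub>j + (2 r\<^sub>j + 1)\<close>. As \<open>m\<close> is odd, \<open>j \<mapsto> r\<^sub>j\<close> permutes \<open>{0..<N}\<close>, and it changes
  the sign \<open>(-1) ^ j\<close> by the constant factor \<open>\<epsilon> = (-1) ^ ((m - 1) / 2)\<close>. Expanding
  \<open>(2 r\<^sub>j + 1) ^ p\<close> to first order in \<open>2 N\<close>, the sum \<open>S = \<Sum>j<N. (-1) ^ j * (2 j + 1) ^ p\<close> satisfies
  \<open>(m ^ p - \<epsilon>) S \<equiv> 2 N p m ^ k \<Sum>j<N. (-1) ^ j * (2 j + 1) ^ k * q\<^sub>j\<close> modulo \<open>4 N\<^sup>2\<close>.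
  On the other hand \<open>S\<close> telescopes to a value of an Euler polynomial, whence
  \<open>S \<equiv> - N p E\<^sub>k\<close> modulo \<open>4 N\<^sup>2\<close>. It remains to cancel \<open>N\<close> and the odd number \<open>p\<close>.\<close>

section \<open>Euler numbers: vanishing at odd indices and the symmetric recurrence\<close>

lemma euler_number_0 [simp]: "euler_number 0 = 1"
  by (simp add: euler_number.simps)

text \<open>The recursion links only indices of equal parity, so an odd index never reaches the
  initial value at 0.\<close>

lemma euler_number_odd:
  assumes "odd n"
  shows "euler_number n = 0"
  using assms
proof (induction n rule: less_induct)
  case (less n)
  have "(\<Sum>k | k \<le> n - 1 \<and> even (n - k). int (n choose k) * euler_number k) = 0"
  proof (rule sum.neutral, safe)
    fix k assume k: "k \<le> n - 1" "even (n - k)"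
    with less.prems have "k < n" "odd k"
      by (auto elim: oddE)
    with less.IH show "int (n choose k) * euler_number k = 0"
      by simp
  qed
  then show ?case
    using euler_number.simps[of n] odd_pos [OF less.prems] by (simp only: if_False minus_zero) simp
qed

text \<open>The factor \<open>1 + (-1) ^ (n - k)\<close> doubles the terms of the defining recursion
  and kills the rest, which turns it into a full binomial convolution.\<close>

lemma euler_number_recurrence:
  assumes "n > 0"
  shows "(\<Sum>k\<le>n. int (n choose k) * (1 + (-1) ^ (n - k)) * euler_number k) = 0"
proof -
  let ?f = "\<lambda>k. int (n choose k) * euler_number k"
  let ?A = "{k. k \<le> n - 1 \<and> even (n - k)}"
  have "(\<Sum>k\<le>n. int (n choose k) * (1 + (-1) ^ (n - k)) * euler_number k)
      = (\<Sum>k\<le>n. if even (n - k) then 2 * ?f k else 0)"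
    by (intro sum.cong) auto
  also have "\<dots> = (\<Sum>k | k \<in> {..n} \<and> even (n - k). 2 * ?f k)"
    by (rule sum.inter_filter [symmetric]) simp
  also have "{k. k \<in> {..n} \<and> even (n - k)} = insert n ?A"
    using assms by auto
  also have "(\<Sum>k\<in>insert n ?A. 2 * ?f k) = 2 * ?f n + (\<Sum>k\<in>?A. 2 * ?f k)"
    using assms by (intro sum.insert) auto
  also have "\<dots> = 2 * (euler_number n + (\<Sum>k\<in>?A. ?f k))"
    by (simp add: sum_distrib_left)
  also have "\<dots> = 0"
    using assms euler_number.simps[of n] by simp
  finally show ?thesis .
qed

section \<open>The scaled Euler polynomials and their functional equation\<close>

text \<open>This is \<open>2 ^ p E\<^sub>p((x + 1) / 2)\<close>, where \<open>E\<^sub>p\<close> is the Euler polynomial.\<close>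

definition scaled_euler_poly :: "nat \<Rightarrow> int \<Rightarrow> int" where
  "scaled_euler_poly p x = (\<Sum>i\<le>p. int (p choose i) * euler_number i * x ^ (p - i))"

lemma scaled_euler_poly_0: "scaled_euler_poly p 0 = euler_number p"
proof -
  have "scaled_euler_poly p 0 = (\<Sum>i\<le>p. if i = p then euler_number i else 0)"
    unfolding scaled_euler_poly_def by (intro sum.cong) auto
  then show ?thesis by simp
qed

lemma power_add_one_plus_power_diff_one:
  "(x + 1) ^ d + (x - 1) ^ d = (\<Sum>s\<le>d. int (d choose s) * (1 + (-1) ^ s) * x ^ (d - s))"
proof -
  have "(x + 1) ^ d + (x - 1) ^ d = (1 + x) ^ d + (-1 + x) ^ d"
    by (simp add: add.commute)
  then show ?thesis
    by (simp only: binomial_ring [of _ x]) (simp add: sum.distrib [symmetric] algebra_simps)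
qed

text \<open>In exponential generating functions this is
  \<open>sech t * e^(x t) * (e^t + e^(-t)) = 2 e^(x t)\<close>; the proof compares
  coefficients.\<close>

lemma scaled_euler_poly_functional_eq:
  "scaled_euler_poly p (x + 1) + scaled_euler_poly p (x - 1) = 2 * x ^ p"
proof -
  let ?g = "\<lambda>i s. int (p choose i) * euler_number i *
      (int ((p - i) choose s) * (1 + (-1) ^ s) * x ^ (p - i - s))"
  have "scaled_euler_poly p (x + 1) + scaled_euler_poly p (x - 1)
      = (\<Sum>i\<le>p. int (p choose i) * euler_number i * ((x + 1) ^ (p - i) + (x - 1) ^ (p - i)))"
    by (simp add: scaled_euler_poly_def sum.distrib [symmetric] algebra_simps)
  also have "\<dots> = (\<Sum>i\<le>p. \<Sum>s\<le>p - i. ?g i s)"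
    by (simp only: power_add_one_plus_power_diff_one sum_distrib_left)
  also have "\<dots> = (\<Sum>(i, s)\<in>(SIGMA i:{..p}. {..p - i}). ?g i s)"
    by (rule sum.Sigma) auto
  also have "\<dots> = (\<Sum>(i, s) | i + s \<le> p. ?g i s)"
    by (rule sum.cong) auto
  \<comment> \<open>Collect terms by \<open>l = i + s\<close>, the amount by which the exponent of
    \<open>x\<close> falls short of \<open>p\<close>; the inner sum becomes the recurrence for index
    \<open>l\<close>.\<close>
  also have "\<dots> = (\<Sum>l\<le>p. \<Sum>i\<le>l. ?g i (l - i))"
    by (rule sum.triangle_reindex_eq)
  also have "\<dots> = (\<Sum>l\<le>p. int (p choose l) * x ^ (p - l) *
      (\<Sum>i\<le>l. int (l choose i) * (1 + (-1) ^ (l - i)) * euler_number i))"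
    unfolding sum_distrib_left
  proof (intro sum.cong refl)
    fix l i assume "l \<in> {..p}" "i \<in> {..l}"
    then have "i \<le> l" "l \<le> p" by auto
    from choose_mult [OF this]
    have "int (p choose i) * int ((p - i) choose (l - i)) = int (p choose l) * int (l choose i)"
      by (metis of_nat_mult)
    moreover have "p - i - (l - i) = p - l"
      using \<open>i \<le> l\<close> by simp
    ultimately show "?g i (l - i)
        = int (p choose l) * x ^ (p - l) * (int (l choose i) * (1 + (-1) ^ (l - i)) * euler_number i)"
      by (simp add: algebra_simps)
  qed
  also have "\<dots> = (\<Sum>l\<le>p. if l = 0 then 2 * x ^ p else 0)"
    by (intro sum.cong) (auto simp: euler_number_recurrence)
  finally show ?thesis by simp
qed

section \<open>Alternating sums of odd powers and their residues\<close>

text \<open>At \<open>x = 2 j + 1\<close> the functional equation writes each summand through values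
  at \<open>2 j\<close> and \<open>2 j + 2\<close>; the alternating signs make the sum
  telescope.\<close>

lemma alternating_odd_power_sum:
  "2 * (\<Sum>j<M. (-1) ^ j * (2 * int j + 1) ^ p)
    = scaled_euler_poly p 0 - (-1) ^ M * scaled_euler_poly p (2 * int M)"
proof (induction M)
  case (Suc M)
  have "2 * (2 * int M + 1) ^ p = scaled_euler_poly p (2 * int (Suc M)) + scaled_euler_poly p (2 * int M)"
    using scaled_euler_poly_functional_eq [of p "2 * int M + 1"] by (simp add: algebra_simps)
  then have "2 * ((-1) ^ M * (2 * int M + 1) ^ p)
      = (-1) ^ M * (scaled_euler_poly p (2 * int (Suc M)) + scaled_euler_poly p (2 * int M))"
    by simp
  with Suc.IH show ?case
    by (simp add: distrib_left distrib_right)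
qed simp

text \<open>The constant and quadratic terms carry Euler numbers of odd index, hence vanish; only
  the linear term survives below \<open>x ^ 3\<close>.\<close>

lemma scaled_euler_poly_cong:
  assumes "even k"
  shows "[scaled_euler_poly (Suc k) x = int (Suc k) * euler_number k * x] (mod x ^ 3)"
proof -
  let ?f = "\<lambda>i. int (Suc k choose i) * euler_number i * x ^ (Suc k - i)"
  have "x ^ 3 dvd ?f i" if "i < k" for i
  proof (cases "odd i")
    case True
    then show ?thesis by (simp add: euler_number_odd)
  next
    case False
    \<comment> \<open>Both \<open>i\<close> and \<open>k\<close> are even, so \<open>i < k\<close>
      forces \<open>i \<le> k - 2\<close>.\<close>
    with assms that have "3 \<le> Suc k - i"
      by presburger
    then show ?thesis
      using le_imp_power_dvd dvd_mult by blast
  qed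
  then have "x ^ 3 dvd (\<Sum>i<k. ?f i)"
    by (intro dvd_sum) auto
  moreover have "scaled_euler_poly (Suc k) x = (\<Sum>i<k. ?f i) + int (Suc k) * euler_number k * x"
    using assms
    by (simp add: scaled_euler_poly_def lessThan_Suc_atMost [symmetric] euler_number_odd
        del: binomial_Suc_Suc)
  ultimately show ?thesis
    by (simp add: cong_iff_dvd_diff)
qed

text \<open>Apply the previous congruence at \<open>x = 2 M\<close>. Halving \<open>8 M^3\<close>
  leaves \<open>4 M^3\<close>, weakened to \<open>4 M^2\<close> to match the first-order expansion
  used for the residues.\<close>

lemma alternating_odd_power_sum_cong:
  assumes "even k" and "even M"
  shows "[(\<Sum>j<M. (-1) ^ j * (2 * int j + 1) ^ Suc k) = - (int M * int (Suc k) * euler_number k)]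
    (mod 4 * int M ^ 2)"
proof -
  let ?S = "\<Sum>j<M. (-1) ^ j * (2 * int j + 1) ^ Suc k"
  have "2 * ?S = - scaled_euler_poly (Suc k) (2 * int M)"
    using alternating_odd_power_sum [of "Suc k" M] assms
    by (simp add: scaled_euler_poly_0 euler_number_odd)
  then have "2 * (?S + int M * int (Suc k) * euler_number k)
      = - (scaled_euler_poly (Suc k) (2 * int M) - int (Suc k) * euler_number k * (2 * int M))"
    by (simp add: algebra_simps)
  then have "(2 * int M) ^ 3 dvd 2 * (?S + int M * int (Suc k) * euler_number k)"
    using scaled_euler_poly_cong [OF assms(1), of "2 * int M"]
    by (simp only: cong_iff_dvd_diff dvd_minus_iff)
  moreover have "(2 * int M) ^ 3 = 2 * (4 * int M ^ 2 * int M)"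
    by (simp add: power2_eq_square power3_eq_cube)
  ultimately have "4 * int M ^ 2 * int M dvd ?S + int M * int (Suc k) * euler_number k"
    by (simp only: dvd_mult_cancel_left) simp
  then have "4 * int M ^ 2 dvd ?S + int M * int (Suc k) * euler_number k"
    by (rule dvd_mult_left)
  then show ?thesis
    by (simp only: cong_iff_dvd_diff diff_minus_eq_add)
qed

section \<open>Permuting the sum by multiplication with an odd number\<close>

lemma power_diff_cong_first_order:
  fixes a b :: int
  shows "[(a - b) ^ Suc k = a ^ Suc k - int (Suc k) * b * a ^ k] (mod b ^ 2)"
proof (induction k)
  case (Suc k)
  have "[(a - b) * (a - b) ^ Suc k = (a - b) * (a ^ Suc k - int (Suc k) * b * a ^ k)] (mod b ^ 2)"
    using Suc.IH by (rule cong_scalar_left)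
  moreover have "(a - b) * (a ^ Suc k - int (Suc k) * b * a ^ k)
      = (a ^ Suc (Suc k) - int (Suc (Suc k)) * b * a ^ Suc k) + b ^ 2 * (int (Suc k) * a ^ k)"
    by (simp add: algebra_simps power2_eq_square)
  ultimately show ?case
    by (simp add: cong_def)
qed simp

lemma bij_betw_affine_mod:
  fixes M m h :: nat
  assumes "coprime m M" and "M > 0"
  shows "bij_betw (\<lambda>j. (j * m + h) mod M) {..<M} {..<M}"
proof -
  have "inj_on (\<lambda>j. (j * m + h) mod M) {..<M}"
  proof (rule inj_onI)
    fix i j assume "i \<in> {..<M}" "j \<in> {..<M}" and "(i * m + h) mod M = (j * m + h) mod M"
    then have "[i * m = j * m] (mod M)"
      by (simp add: cong_add_rcancel_nat flip: cong_def)
    with assms(1) have "[i = j] (mod M)"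
      using cong_mult_rcancel_nat by blast
    with \<open>i \<in> {..<M}\<close> \<open>j \<in> {..<M}\<close> show "i = j"
      by (simp add: cong_def)
  qed
  moreover have "(\<lambda>j. (j * m + h) mod M) ` {..<M} \<subseteq> {..<M}"
    using assms(2) by auto
  ultimately show ?thesis
    by (simp add: bij_betw_def endo_inj_surj)
qed

lemma alternating_odd_power_sum_twist_cong:
  fixes M h k :: nat
  assumes "even M" and "M > 0" and "coprime (2 * h + 1) M"
  defines "m \<equiv> 2 * h + 1"
  shows "[(int m ^ Suc k - (-1) ^ h) * (\<Sum>j<M. (-1) ^ j * (2 * int j + 1) ^ Suc k)
      = 2 * int M * int (Suc k) * int m ^ k *
        (\<Sum>j<M. (-1) ^ j * (2 * int j + 1) ^ k * int ((j * m + h) div M))] (mod 4 * int M ^ 2)"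
proof -
  define r where "r j = (j * m + h) mod M" for j
  define q where "q j = (j * m + h) div M" for j
  define s where "s = (\<lambda>j. (-1) ^ j * (2 * int j + 1) ^ Suc k)"
  define t where "t = (\<lambda>j. (-1) ^ j * (2 * int j + 1) ^ k * int (q j))"
  have eq: "j * m + h = M * q j + r j" for j
    by (simp add: q_def r_def)
  \<comment> \<open>Reduce the division identity modulo 2: \<open>M\<close> is even and
    \<open>m\<close> is odd, so \<open>r j\<close> has the parity of \<open>h + j\<close>.\<close>
  have sign: "(-1) ^ r j = (-1) ^ h * (-1 :: int) ^ j" for j
  proof -
    have "even (r j) \<longleftrightarrow> even (h + j)"
      using arg_cong [OF eq [of j], of even] assms(1) by (auto simp: m_def)
    then show ?thesis
      by (simp add: minus_one_power_iff power_add [symmetric])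
  qed
  have step: "[s (r j) = (-1) ^ h * (int m ^ Suc k * s j - 2 * int M * int (Suc k) * int m ^ k * t j)]
      (mod 4 * int M ^ 2)" for j
  proof -
    let ?a = "int m * (2 * int j + 1)" and ?b = "2 * int M * int (q j)"
    have "int j * int m + int h = int M * int (q j) + int (r j)"
      using arg_cong [OF eq [of j], of int] by simp
    \<comment> \<open>Double the division identity and add 1, using
      \<open>2 * h + 1 = m\<close>.\<close>
    then have ab: "2 * int (r j) + 1 = ?a - ?b"
      by (simp add: m_def algebra_simps)
    have "[(?a - ?b) ^ Suc k = ?a ^ Suc k - int (Suc k) * ?b * ?a ^ k] (mod ?b ^ 2)"
      by (rule power_diff_cong_first_order)
    moreover have "4 * int M ^ 2 dvd ?b ^ 2"
      by (simp add: power_mult_distrib)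
    ultimately have "[(?a - ?b) ^ Suc k = ?a ^ Suc k - int (Suc k) * ?b * ?a ^ k] (mod 4 * int M ^ 2)"
      using cong_dvd_modulus by blast
    then have "[s (r j) = (-1) ^ h * (-1) ^ j * (?a ^ Suc k - int (Suc k) * ?b * ?a ^ k)]
        (mod 4 * int M ^ 2)"
      unfolding s_def sign ab by (rule cong_scalar_left)
    also have "(-1) ^ h * (-1) ^ j * (?a ^ Suc k - int (Suc k) * ?b * ?a ^ k)
        = (-1) ^ h * (int m ^ Suc k * s j - 2 * int M * int (Suc k) * int m ^ k * t j)"
      unfolding power_mult_distrib s_def t_def by (simp add: algebra_simps)
    finally show ?thesis .
  qed
  \<comment> \<open>Since \<open>m\<close> is invertible modulo \<open>M\<close>, \<open>r\<close>
    permutes the index range.\<close>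
  have "(\<Sum>j<M. s j) = (\<Sum>j<M. s (r j))"
    using sum.reindex_bij_betw [OF bij_betw_affine_mod, of m M s h] assms
    by (simp add: r_def)
  also have "[\<dots> = (\<Sum>j<M. (-1) ^ h * (int m ^ Suc k * s j - 2 * int M * int (Suc k) * int m ^ k * t j))]
      (mod 4 * int M ^ 2)"
    by (intro cong_sum step)
  also have "(\<Sum>j<M. (-1) ^ h * (int m ^ Suc k * s j - 2 * int M * int (Suc k) * int m ^ k * t j))
      = (-1) ^ h * (int m ^ Suc k * (\<Sum>j<M. s j) - 2 * int M * int (Suc k) * int m ^ k * (\<Sum>j<M. t j))"
    by (simp only: sum_distrib_left [symmetric] sum_subtractf)
  \<comment> \<open>Multiplying by \<open>(-1) ^ h\<close> moves the sign to the left, since its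
    square is 1.\<close>
  finally have "[(-1) ^ h * (\<Sum>j<M. s j) = (-1) ^ h * ((-1) ^ h *
      (int m ^ Suc k * (\<Sum>j<M. s j) - 2 * int M * int (Suc k) * int m ^ k * (\<Sum>j<M. t j)))]
      (mod 4 * int M ^ 2)"
    by (rule cong_scalar_left)
  also have "(-1) ^ h * ((-1) ^ h *
      (int m ^ Suc k * (\<Sum>j<M. s j) - 2 * int M * int (Suc k) * int m ^ k * (\<Sum>j<M. t j)))
    = int m ^ Suc k * (\<Sum>j<M. s j) - 2 * int M * int (Suc k) * int m ^ k * (\<Sum>j<M. t j)"
    by (simp add: minus_one_power_iff)
  finally have "[2 * int M * int (Suc k) * int m ^ k * (\<Sum>j<M. t j)
      = int m ^ Suc k * (\<Sum>j<M. s j) - (-1) ^ h * (\<Sum>j<M. s j)] (mod 4 * int M ^ 2)"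
    by (simp only: cong_iff_dvd_diff) (simp add: algebra_simps)
  then show ?thesis
    unfolding s_def t_def q_def by (simp only: left_diff_distrib cong_sym_eq)
qed

section \<open>The integer congruence for Euler numbers\<close>

text \<open>Two evaluations of the same multiple of the power sum are compared modulo
  \<open>4 M^2\<close>. Cancelling \<open>M\<close> leaves \<open>4 M\<close>; the spare factor 4
  pays for the denominators in the rational form.\<close>

lemma euler_number_floor_sum_cong:
  fixes n h k :: nat
  assumes "n > 0" and "even k"
  defines "m \<equiv> 2 * h + 1"
  shows "[(int m ^ Suc k - (-1) ^ h) * euler_number k
      = - 2 * int m ^ k * (\<Sum>j<2 ^ n. (-1) ^ j * (2 * int j + 1) ^ k * int ((j * m + h) div 2 ^ n))]
      (mod 4 * 2 ^ n)"
proof -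
  define M :: nat where "M = 2 ^ n"
  let ?c = "int m ^ Suc k - (-1) ^ h"
  let ?S = "\<Sum>j<M. (-1) ^ j * (2 * int j + 1) ^ Suc k"
  let ?T = "\<Sum>j<M. (-1) ^ j * (2 * int j + 1) ^ k * int ((j * m + h) div M)"
  have M: "even M" "M > 0" "coprime (2 * h + 1) M"
    using assms(1) by (auto simp: M_def)
  have "[?c * - (int M * int (Suc k) * euler_number k) = ?c * ?S] (mod 4 * int M ^ 2)"
    by (rule cong_scalar_left, rule cong_sym, rule alternating_odd_power_sum_cong [OF assms(2) M(1)])
  also have "[?c * ?S = 2 * int M * int (Suc k) * int m ^ k * ?T] (mod 4 * int M ^ 2)"
    unfolding m_def by (rule alternating_odd_power_sum_twist_cong [OF M])
  finally have "4 * int M ^ 2 dvd - (int M * (int (Suc k) * (?c * euler_number k + 2 * int m ^ k * ?T)))"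
    by (simp only: cong_iff_dvd_diff) (simp add: algebra_simps)
  then have "int M * (4 * int M) dvd int M * (int (Suc k) * (?c * euler_number k + 2 * int m ^ k * ?T))"
    by (simp only: dvd_minus_iff power2_eq_square mult.left_commute mult.commute)
  then have "4 * int M dvd int (Suc k) * (?c * euler_number k + 2 * int m ^ k * ?T)"
    using M(2) by (simp only: dvd_mult_cancel_left) simp
  \<comment> \<open>\<open>4 M\<close> is a power of 2 and \<open>k + 1\<close> is odd, so
    \<open>k + 1\<close> can be cancelled.\<close>
  moreover have "coprime (4 * int M) (int (Suc k))"
  proof -
    have "4 * int M = 2 ^ (n + 2)"
      by (simp add: M_def)
    moreover have "odd (int (Suc k))"
      using assms(2) by simp
    ultimately show ?thesis
      by (simp only: coprime_power_left_iff coprime_left_2_iff_odd) simp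
  qed
  ultimately have "4 * int M dvd ?c * euler_number k + 2 * int m ^ k * ?T"
    using coprime_dvd_mult_right_iff by blast
  then show ?thesis
    by (simp add: cong_iff_dvd_diff M_def)
qed

section \<open>Passage to rational congruences\<close>

lemma rat_cong_of_int:
  assumes "[a = b] (mod int q)"
  shows "rat_cong (of_int a) (of_int b) q"
proof -
  have int: "of_int c \<in> rat_ring q" for c
    unfolding rat_ring_def by (rule CollectI, rule exI [of _ c], rule exI [of _ 1]) simp
  from assms obtain c where "a - b = int q * c"
    unfolding cong_iff_dvd_diff by blast
  then have "of_int a - of_int b = (of_nat q * of_int c :: rat)"
    by (metis of_int_diff of_int_mult of_int_of_nat_eq)
  with int show ?thesis
    unfolding rat_cong_def by blast
qed

text \<open>An odd exponent preserves the sign in \<open>2 h + 1 \<equiv> (-1)^h\<close> modulo 4.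
  This makes the coefficient of the Euler number an integer after division by 4.\<close>

lemma odd_power_Suc_cong_4:
  assumes "even k"
  shows "[int (2 * h + 1) ^ Suc k = (-1) ^ h] (mod 4)"
proof -
  have base: "[int (2 * h + 1) = (-1) ^ h] (mod 4)"
    by (cases "even h") (auto simp: cong_iff_dvd_diff elim!: evenE oddE)
  then have "[int (2 * h + 1) ^ Suc k = ((-1) ^ h) ^ Suc k] (mod 4)"
    by (rule cong_pow)
  also have "((-1) ^ h) ^ Suc k = (-1 :: int) ^ h"
    using assms by (auto simp: minus_one_power_iff)
  finally show ?thesis .
qed

text \<open>Both sides are in fact integers, \<open>c * euler_number k\<close> and
  \<open>- (m ^ k * u)\<close>, so the claim is the integer congruence divided by 4.\<close>

lemma rat_cong_euler_number_floor_sum: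
  fixes n k m :: nat
  assumes "n > 0" and "even k" and "odd m"
  shows "rat_cong
           ((of_nat m ^ (k + 1) - (-1) ^ ((m - 1) div 2)) / 4 * of_int (euler_number k))
           (of_nat m ^ k / 2 * (\<Sum>j = 0..2 ^ n - 1. (-1) powi (int j - 1) * (2 * of_nat j + 1) ^ k
              * of_int \<lfloor>(of_nat j * of_nat m + (of_nat m - 1) / 2) / 2 ^ n :: rat\<rfloor>))
           (2 ^ n)" (is "rat_cong ?L ?R _")
proof -
  from assms(3) obtain h where m: "m = 2 * h + 1"
    by (elim oddE)
  define T where "T = (\<Sum>j<2 ^ n. (-1) ^ j * (2 * int j + 1) ^ k * int ((j * m + h) div 2 ^ n))"
  have main: "4 * 2 ^ n dvd (int m ^ Suc k - (-1) ^ h) * euler_number k - (- 2 * int m ^ k * T)"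
    using euler_number_floor_sum_cong [OF assms(1,2), of h]
    by (simp only: T_def m cong_iff_dvd_diff)
  obtain c where c: "int m ^ Suc k - (-1) ^ h = 4 * c"
    using odd_power_Suc_cong_4 [OF assms(2), of h] unfolding m cong_iff_dvd_diff by blast
  \<comment> \<open>The integer congruence itself, read modulo 4, forces \<open>T\<close> to be even
    because \<open>m\<close> is odd.\<close>
  have "4 dvd 4 * y + 2 * z \<Longrightarrow> even z" for y z :: int
    by presburger
  moreover have "4 dvd 4 * (c * euler_number k) + 2 * (int m ^ k * T)"
    using dvd_mult_left [OF main] unfolding c by (simp only: diff_minus_eq_add minus_mult_left [symmetric] mult.assoc)
  ultimately have "even (int m ^ k * T)"
    by blast
  then have "even T"
    using assms(3) by simp
  then obtain u where u: "T = 2 * u"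
    by (elim evenE)
  have "4 * 2 ^ n dvd 4 * (c * euler_number k - (- (int m ^ k * u)))"
    using main unfolding c u by (simp add: algebra_simps)
  then have "[c * euler_number k = - (int m ^ k * u)] (mod int (2 ^ n))"
    by (simp only: cong_iff_dvd_diff dvd_mult_cancel_left) simp
  then have "rat_cong (of_int (c * euler_number k)) (of_int (- (int m ^ k * u))) (2 ^ n)"
    by (rule rat_cong_of_int)
  moreover have "?L = of_int (c * euler_number k)"
  proof -
    have "of_nat m ^ (k + 1) - (-1) ^ ((m - 1) div 2) = (of_int (int m ^ Suc k - (-1) ^ h) :: rat)"
      by (simp add: m)
    then show ?thesis
      by (simp only: c) simp
  qed
  moreover have "?R = of_int (- (int m ^ k * u))"
  proof -
    have summand: "(-1) powi (int j - 1) * (2 * of_nat j + 1) ^ k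
          * of_int \<lfloor>(of_nat j * of_nat m + (of_nat m - 1) / 2) / 2 ^ n :: rat\<rfloor>
        = (of_int (- ((-1) ^ j * (2 * int j + 1) ^ k * int ((j * m + h) div 2 ^ n))) :: rat)" for j
    proof -
      have "(of_nat j * of_nat m + (of_nat m - 1) / 2) / 2 ^ n
          = (of_nat (j * m + h) / of_nat (2 ^ n) :: rat)"
        by (simp add: m distrib_left)
      then have "\<lfloor>(of_nat j * of_nat m + (of_nat m - 1) / 2) / 2 ^ n :: rat\<rfloor> = int ((j * m + h) div 2 ^ n)"
        by (simp only: floor_divide_of_nat_eq)
      \<comment> \<open>The integer exponent is -1 at \<open>j = 0\<close>; the sign is
        \<open>- ((-1) ^ j)\<close> there as well.\<close>
      moreover have "(-1) powi (int j - 1) = (- ((-1) ^ j) :: rat)"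
        by (simp add: power_int_diff)
      ultimately show ?thesis
        by simp
    qed
    have "{0..2 ^ n - 1} = {..<(2 :: nat) ^ n}"
      by (simp add: atLeast0AtMost lessThan_Suc_atMost [symmetric])
    then have "?R = of_nat m ^ k / 2 * of_int (- T)"
      unfolding summand T_def by (simp add: sum_negf)
    then show ?thesis
      by (simp add: u)
  qed
  ultimately show ?thesis
    by (simp only:)
qed

theorem theorem1p1:
  fixes n k :: nat
  assumes "n > 0" and "even k"
  shows "rat_cong
           ((3 ^ (k + 1) + 1) / 4 * of_int (euler_number k))
           (3 ^ k / 2 * (\<Sum>j = 0..2 ^ n - 1. (-1) powi (int j - 1) * (2 * of_nat j + 1) ^ k
              * of_int \<lfloor>(3 * of_nat j + 1) / 2 ^ n :: rat\<rfloor>))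
           (2 ^ n)
       \<and> (\<forall>m :: nat. m > 0 \<and> odd m \<longrightarrow>
         rat_cong
           ((of_nat m ^ (k + 1) - (-1) ^ ((m - 1) div 2)) / 4 * of_int (euler_number k))
           (of_nat m ^ k / 2 * (\<Sum>j = 0..2 ^ n - 1. (-1) powi (int j - 1) * (2 * of_nat j + 1) ^ k
              * of_int \<lfloor>(of_nat j * of_nat m + (of_nat m - 1) / 2) / 2 ^ n :: rat\<rfloor>))
           (2 ^ n))"
proof -
  \<comment> \<open>The first congruence is the case \<open>m = 3\<close>, where
    \<open>(m - 1) / 2 = 1\<close> turns the sign term into \<open>+ 1\<close>.\<close>
  have const: "(of_nat 3 ^ (k + 1) - (-1) ^ ((3 - 1) div 2) :: rat) = 3 ^ (k + 1) + 1"
    by simp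
  have floor: "(of_nat j * of_nat 3 + (of_nat 3 - 1) / 2 :: rat) = 3 * of_nat j + 1" for j
    by simp
  have three: "of_nat 3 ^ k = (3 ^ k :: rat)"
    by simp
  have "odd (3 :: nat)"
    by simp
  from rat_cong_euler_number_floor_sum [OF assms this, unfolded const floor three]
  show ?thesis
    using rat_cong_euler_number_floor_sum [OF assms] by blast
qed

end
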